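(* Let $\mathcal{B}$ be a Banach space of type $p\in(1,2]$ and type constant $T$, and let $R,\Delta>0$. The VC dimension of gap-tolerant classifiers whose margin is $\Delta$ over a ball of radius $R$ in $\mathcal{B}$ is bounded above by $$\left(\frac{3TR}{\Delta}\right)^{\frac{p}{p-1}}+64 .$$
   Context: A Banach space $\mathcal{B}$ has (Rademacher) type $p$ if there is $T<\infty$ such that for all $n$ and all $x_1,\dots,x_n\in\mathcal{B}$, $\mathbb{E}_\epsilon\big[\|\sum_{i=1}^n\epsilon_i x_i\|^p\big]\le T^p\sum_{i=1}^n\|x_i\|^p$, where $\epsilon_i$ are independent uniform $\pm1$ signs; the smallest such $T$ is the type constant. A gap-tolerant classifier with margin $\Delta$ consists of an oriented affine hyperplane together with its margin, the set of points at norm-distance less than $\Delta$ from the hyperplane. Points outside the margin are labeled $\pm1$ according to the side on which they lie; points in the margin receive no label. A finite set of points is shattered if for every assignment of labels $\pm1$ to its points some gap-tolerant classifier with margin $\Delta$ has all the points outside its margin and labels them as assigned. The VC dimension over a ball is the largest size of a shattered set of points in the ball. *)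

theory Defs
  imports "HOL-Probability.Probability"
begin

text \<open>The sum of the signed vectors is averaged over a family of independent uniform signs;
  the \<open>0\<close> is the irrelevant value of the family outside the index set.\<close>

definition rademacher_type_bound :: "'a::real_normed_vector itself \<Rightarrow> real \<Rightarrow> real \<Rightarrow> bool" where
  "rademacher_type_bound _ p T \<longleftrightarrow> 0 \<le> T \<and>
     (\<forall>n (x :: nat \<Rightarrow> 'a).
        measure_pmf.expectation (Pi_pmf {..<n} 0 (\<lambda>_. pmf_of_set {- 1, 1 :: real}))
          (\<lambda>\<epsilon>. norm (\<Sum>i<n. \<epsilon> i *\<^sub>R x i) powr p)
        \<le> T powr p * (\<Sum>i<n. norm (x i) powr p))"

definition has_rademacher_type :: "'a::real_normed_vector itself \<Rightarrow> real \<Rightarrow> bool" where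
  "has_rademacher_type a p \<longleftrightarrow> (\<exists>T. rademacher_type_bound a p T)"

definition rademacher_type_constant :: "'a::real_normed_vector itself \<Rightarrow> real \<Rightarrow> real" where
  "rademacher_type_constant a p = (LEAST T. rademacher_type_bound a p T)"

text \<open>The minimum in the definition of the type constant is attained.\<close>

lemma rademacher_type_constant_bound:
  fixes a :: "'a::real_normed_vector itself"
  assumes "0 < p" and "has_rademacher_type a p"
  shows "rademacher_type_bound a p (rademacher_type_constant a p)"
proof -
  define E where "E = (\<lambda>n (x :: nat \<Rightarrow> 'a).
     measure_pmf.expectation (Pi_pmf {..<n} 0 (\<lambda>_. pmf_of_set {- 1, 1 :: real}))
          (\<lambda>\<epsilon>. norm (\<Sum>i<n. \<epsilon> i *\<^sub>R x i) powr p))"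
  define S where "S = Collect (rademacher_type_bound a p)"
  have S_eq: "S = (\<Inter>n. \<Inter>x. {T \<in> {0..}. E n x \<le> T powr p * (\<Sum>i<n. norm (x i) powr p)})"
    unfolding S_def rademacher_type_bound_def E_def by auto
  have "closed {T \<in> {0..}. E n x \<le> T powr p * (\<Sum>i<n. norm (x i) powr p)}" for n x
    using \<open>0 < p\<close> by (intro continuous_on_closed_Collect_le continuous_on_mult continuous_on_powr'
        continuous_on_const continuous_on_id) auto
  then have "closed S"
    unfolding S_eq by blast
  moreover have "S \<noteq> {}"
    using assms(2) unfolding S_def has_rademacher_type_def by auto
  moreover have bdd: "bdd_below S"
    by (rule bdd_belowI[of _ 0]) (auto simp: S_def rademacher_type_bound_def)
  ultimately have "Inf S \<in> S"
    by (intro closed_contains_Inf) auto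
  moreover have "Inf S \<le> T" if "rademacher_type_bound a p T" for T
    using that bdd by (auto simp: S_def intro: cInf_lower)
  ultimately show ?thesis
    unfolding rademacher_type_constant_def S_def by (auto intro: LeastI2_order)
qed

text \<open>The classifier of the hyperplane \<open>f = b\<close>, oriented towards \<open>b < f x\<close>. Points of the margin
  get no label; outside it \<open>f x \<noteq> b\<close>, so that the label is \<open>1\<close> or \<open>- 1\<close>.\<close>

definition gap_tolerant_classifier ::
    "real \<Rightarrow> ('a::real_normed_vector \<Rightarrow> real) \<Rightarrow> real \<Rightarrow> 'a \<Rightarrow> real option" where
  "gap_tolerant_classifier \<Delta> f b x =
     (if infdist x {y. f y = b} < \<Delta> then None else Some (sgn (f x - b)))"

text \<open>Only closed hyperplanes are taken: a non-closed one is dense, so that its margin is the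
  whole space.\<close>

definition gap_tolerant_classifiers :: "real \<Rightarrow> ('a::real_normed_vector \<Rightarrow> real option) set" where
  "gap_tolerant_classifiers \<Delta> =
     {gap_tolerant_classifier \<Delta> f b | f b. bounded_linear f \<and> f \<noteq> (\<lambda>_. 0)}"

definition shattered_by :: "('a \<Rightarrow> real option) set \<Rightarrow> 'a set \<Rightarrow> bool" where
  "shattered_by C S \<longleftrightarrow>
     (\<forall>y. y ` S \<subseteq> {- 1, 1} \<longrightarrow> (\<exists>h\<in>C. \<forall>x\<in>S. h x = Some (y x)))"

text \<open>The value is \<open>\<infinity>\<close> if shattered sets of every size exist.\<close>

definition VC_dimension :: "('a \<Rightarrow> real option) set \<Rightarrow> 'a set \<Rightarrow> enat" where
  "VC_dimension C B = (SUP S \<in> {S. finite S \<and> S \<subseteq> B \<and> shattered_by C S}. enat (card S))"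

end

theory Submission
  imports Defs
begin

text \<open>Pair up the points of a shattered set of size \<open>2m\<close> or \<open>2m + 1\<close> and give the two points of
  each pair opposite labels. The offset of the separating hyperplane then cancels, so that every
  signed sum of the \<open>m\<close> differences has norm at least \<open>2m\<Delta>\<close>. The differences have norm at most
  \<open>2R\<close>, so averaging over the signs gives \<open>(2m\<Delta>)\<^sup>p \<le> T\<^sup>p m (2R)\<^sup>p\<close>, that is,
  \<open>m \<le> (TR/\<Delta>)\<close> to the power \<open>p/(p - 1)\<close>.\<close>

text \<open>Walking from \<open>x\<close> in direction \<open>v\<close> meets the hyperplane after a
  length of \<open>\<bar>f x - b\<bar> * norm v / \<bar>f v\<bar>\<close>. The product form avoids
  the operator norm of \<open>f\<close> and includes directions with \<open>f v = 0\<close>.\<close>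

lemma infdist_hyperplane_mult_le:
  fixes f :: "'a::real_normed_vector \<Rightarrow> real"
  assumes "linear f"
  shows "infdist x {y. f y = b} * \<bar>f v\<bar> \<le> \<bar>f x - b\<bar> * norm v"
proof (cases "f v = 0")
  case False
  define t where "t = (b - f x) / f v"
  have "f (x + t *\<^sub>R v) = b"
    using False by (simp add: linear_add[OF assms] linear_scale[OF assms] t_def)
  then have "infdist x {y. f y = b} \<le> dist x (x + t *\<^sub>R v)"
    by (intro infdist_le) simp
  also have "\<dots> = \<bar>f x - b\<bar> * norm v / \<bar>f v\<bar>"
    by (simp add: dist_norm t_def abs_minus_commute)
  finally show ?thesis
    using False by (simp add: field_simps)
qed simp

text \<open>The label is the sign of \<open>f x - b\<close>, so \<open>y * (f x - b)\<close> is the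
  absolute value that controls the distance. Restricting \<open>y\<close> to signs excludes
  \<open>sgn 0\<close>. The vector \<open>v\<close> stays free so that a signed sum can be inserted
  later.\<close>

lemma gap_tolerant_classifier_eq_SomeD:
  assumes "gap_tolerant_classifier \<Delta> f b x = Some y" and "y \<in> {- 1, 1}" and "linear f"
  shows "y * (f x - b) > 0" and "\<Delta> * \<bar>f v\<bar> \<le> y * (f x - b) * norm v"
proof -
  have dist: "\<Delta> \<le> infdist x {y. f y = b}" and y: "sgn (f x - b) = y"
    using assms(1) by (auto simp: gap_tolerant_classifier_def split: if_splits)
  have y_abs: "y * (f x - b) = \<bar>f x - b\<bar>"
    using y by (simp add: abs_sgn mult.commute)
  show "y * (f x - b) > 0"
    using y assms(2) unfolding y_abs by auto
  have "\<Delta> * \<bar>f v\<bar> \<le> infdist x {y. f y = b} * \<bar>f v\<bar>"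
    using dist by (intro mult_right_mono) auto
  then show "\<Delta> * \<bar>f v\<bar> \<le> y * (f x - b) * norm v"
    using infdist_hyperplane_mult_le[OF assms(3)] unfolding y_abs by (rule order_trans)
qed

lemma norm_signed_differences_ge:
  fixes u w :: "nat \<Rightarrow> 'a::real_normed_vector"
  assumes "h \<in> gap_tolerant_classifiers \<Delta>"
    and "\<And>i. i < m \<Longrightarrow> h (u i) = Some (\<epsilon> i)" and "\<And>i. i < m \<Longrightarrow> h (w i) = Some (- \<epsilon> i)"
    and "\<And>i. i < m \<Longrightarrow> \<epsilon> i \<in> {- 1, 1}"
  shows "2 * real m * \<Delta> \<le> norm (\<Sum>i<m. \<epsilon> i *\<^sub>R (u i - w i))"
proof (cases "m = 0")
  case False
  obtain f b where h: "h = gap_tolerant_classifier \<Delta> f b" and "bounded_linear f"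
    using assms(1) unfolding gap_tolerant_classifiers_def by auto
  then have lin: "linear f"
    by (simp add: bounded_linear.linear)
  define v where "v = (\<Sum>i<m. \<epsilon> i *\<^sub>R (u i - w i))"
  \<comment> \<open>In each pair the two offsets \<open>b\<close> cancel, so \<open>g i\<close> is
    the value of \<open>f\<close> at the \<open>i\<close>-th signed difference, split into two terms
    that the margin bounds separately.\<close>
  define g where "g i = \<epsilon> i * (f (u i) - b) + - \<epsilon> i * (f (w i) - b)" for i
  have neg: "- \<epsilon> i \<in> {- 1, 1}" if "i < m" for i
    using assms(4)[OF that] by auto
  note u = gap_tolerant_classifier_eq_SomeD[OF assms(2)[unfolded h] assms(4) lin]
  note w = gap_tolerant_classifier_eq_SomeD[OF assms(3)[unfolded h] neg lin]
  have fv: "f v = (\<Sum>i<m. g i)"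
    unfolding v_def g_def
    by (simp add: linear_sum[OF lin] linear_scale[OF lin] linear_diff[OF lin] algebra_simps)
  have "g i > 0" if "i < m" for i
    unfolding g_def using u(1) w(1) that by (intro add_pos_pos) auto
  then have pos: "f v > 0"
    unfolding fv using False by (intro sum_pos) auto
  \<comment> \<open>The margin bound is applied in the direction of the signed sum \<open>v\<close>
    itself. After summation \<open>f v\<close> stands on both sides and cancels, being
    positive.\<close>
  have "2 * (\<Delta> * \<bar>f v\<bar>) \<le> g i * norm v" if "i < m" for i
    using u(2)[OF that that, of v] w(2)[OF that that, of v] unfolding g_def distrib_right by linarith
  then have "(\<Sum>i<m. 2 * (\<Delta> * \<bar>f v\<bar>)) \<le> (\<Sum>i<m. g i * norm v)"
    by (intro sum_mono) auto
  then have "(2 * real m * \<Delta>) * f v \<le> norm v * f v"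
    unfolding fv sum_distrib_right[symmetric] using pos by (simp add: fv mult_ac)
  then show ?thesis
    using pos unfolding v_def by simp
qed simp

text \<open>A bound valid for every choice of signs passes to the average. The finite support of the
  sign family makes the integrand integrable.\<close>

lemma rademacher_type_bound_lower:
  fixes x :: "nat \<Rightarrow> 'a::real_normed_vector"
  assumes "rademacher_type_bound TYPE('a) p T" and "0 \<le> p" and "0 \<le> c"
    and "\<And>\<epsilon>. \<epsilon> \<in> {..<n} \<rightarrow> {- 1, 1} \<Longrightarrow> c \<le> norm (\<Sum>i<n. \<epsilon> i *\<^sub>R x i)"
  shows "c powr p \<le> T powr p * (\<Sum>i<n. norm (x i) powr p)"
proof -
  define M where "M = Pi_pmf {..<n} 0 (\<lambda>_. pmf_of_set {- 1, 1 :: real})"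
  have supp: "set_pmf M = PiE_dflt {..<n} 0 (\<lambda>_. {- 1, 1})"
    unfolding M_def by (subst set_Pi_pmf) (auto simp: set_pmf_of_set o_def)
  then have fin: "finite (set_pmf M)"
    by (simp add: finite_PiE_dflt)
  have "AE \<epsilon> in measure_pmf M. c powr p \<le> norm (\<Sum>i<n. \<epsilon> i *\<^sub>R x i) powr p"
    unfolding AE_measure_pmf_iff supp
    using assms(2-4) by (intro ballI powr_mono2) (auto simp: PiE_dflt_def Pi_def)
  then have "c powr p \<le> measure_pmf.expectation M (\<lambda>\<epsilon>. norm (\<Sum>i<n. \<epsilon> i *\<^sub>R x i) powr p)"
    by (intro measure_pmf.integral_ge_const integrable_measure_pmf_finite fin)
  then show ?thesis
    using assms(1) unfolding rademacher_type_bound_def M_def by (meson order_trans)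
qed

lemma shattered_by_signed_pairs:
  fixes u w :: "nat \<Rightarrow> 'a"
  assumes "shattered_by C S" and "inj_on u {..<m}" and "inj_on w {..<m}"
    and "u ` {..<m} \<inter> w ` {..<m} = {}" and "u ` {..<m} \<subseteq> S" and "w ` {..<m} \<subseteq> S"
    and "\<epsilon> \<in> {..<m} \<rightarrow> {- 1, 1}"
  obtains h where "h \<in> C" and "\<And>i. i < m \<Longrightarrow> h (u i) = Some (\<epsilon> i)"
    and "\<And>i. i < m \<Longrightarrow> h (w i) = Some (- \<epsilon> i)"
proof -
  \<comment> \<open>The signs are carried from indices to points, consistently because the pairs are
    disjoint. The default \<open>1\<close> labels points in no pair, such as the one left over when
    the number of points is odd.\<close>
  define y where "y a = (if a \<in> u ` {..<m} then \<epsilon> (inv_into {..<m} u a)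
    else if a \<in> w ` {..<m} then - \<epsilon> (inv_into {..<m} w a) else 1)" for a
  have yu: "y (u i) = \<epsilon> i" and yw: "y (w i) = - \<epsilon> i" if "i < m" for i
    using that assms(2-4) by (auto simp: y_def inv_into_f_f)
  have "y a \<in> {- 1, 1}" for a
  proof -
    consider i where "i < m" "a = u i" | i where "i < m" "a = w i"
      | "a \<notin> u ` {..<m}" "a \<notin> w ` {..<m}"
      by blast
    then have "(\<exists>i<m. y a = \<epsilon> i \<or> y a = - \<epsilon> i) \<or> y a = 1"
    proof cases
      case 3
      then show ?thesis
        by (simp add: y_def)
    qed (use yu yw in blast)+
    then show ?thesis
      using assms(7) by (auto simp: Pi_def)
  qed
  then obtain h where "h \<in> C" "\<forall>a\<in>S. h a = Some (y a)"
    using assms(1) unfolding shattered_by_def by blast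
  then show thesis
    using that assms(5,6) yu yw by (metis image_subset_iff lessThan_iff)
qed

lemma shattered_half_card_powr_le:
  fixes S :: "'a::real_normed_vector set"
  assumes "rademacher_type_bound TYPE('a) p T" and "0 \<le> p" and "0 \<le> \<Delta>"
    and "finite S" and "S \<subseteq> cball z R" and "shattered_by (gap_tolerant_classifiers \<Delta>) S"
    and "m = card S div 2"
  shows "(2 * real m * \<Delta>) powr p \<le> T powr p * (real m * (2 * R) powr p)"
proof -
  obtain g where g: "bij_betw g {0..<card S} S"
    using ex_bij_betw_nat_finite[OF assms(4)] by blast
  \<comment> \<open>Consecutive points of an enumeration form the pairs; parity keeps the two
    families disjoint.\<close>
  define u where "u i = g (2 * i)" for i
  define w where "w i = g (2 * i + 1)" for i
  have lt: "2 * i < card S" "2 * i + 1 < card S" if "i < m" for i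
    using that assms(7) by auto
  have eq: "g i = g j \<longleftrightarrow> i = j" if "i < card S" "j < card S" for i j
    using g that by (auto simp: bij_betw_def inj_on_def)
  have "g i \<in> S" if "i < card S" for i
    using g that by (auto simp: bij_betw_def)
  then have S: "u ` {..<m} \<subseteq> S" "w ` {..<m} \<subseteq> S"
    using lt by (auto simp: u_def w_def)
  have inj: "inj_on u {..<m}" "inj_on w {..<m}"
    using eq lt by (auto simp: inj_on_def u_def w_def)
  have "u i \<noteq> w j" if "i < m" "j < m" for i j
    unfolding u_def w_def using eq[OF lt(1)[OF that(1)] lt(2)[OF that(2)]] by presburger
  then have disj: "u ` {..<m} \<inter> w ` {..<m} = {}"
    by blast
  have "2 * real m * \<Delta> \<le> norm (\<Sum>i<m. \<epsilon> i *\<^sub>R (u i - w i))"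
    if \<epsilon>: "\<epsilon> \<in> {..<m} \<rightarrow> {- 1, 1}" for \<epsilon>
  proof -
    obtain h where "h \<in> gap_tolerant_classifiers \<Delta>" "\<And>i. i < m \<Longrightarrow> h (u i) = Some (\<epsilon> i)"
        "\<And>i. i < m \<Longrightarrow> h (w i) = Some (- \<epsilon> i)"
      using shattered_by_signed_pairs[OF assms(6) inj disj S \<epsilon>] by blast
    then show ?thesis
      by (rule norm_signed_differences_ge) (use \<epsilon> in auto)
  qed
  then have "(2 * real m * \<Delta>) powr p \<le> T powr p * (\<Sum>i<m. norm (u i - w i) powr p)"
    using assms(1-3) by (intro rademacher_type_bound_lower) auto
  \<comment> \<open>Two points of the ball are at most its diameter apart, by the triangle
    inequality through the centre \<open>z\<close>.\<close>
  also have "\<dots> \<le> T powr p * (\<Sum>i<m. (2 * R) powr p)"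
  proof (intro mult_left_mono sum_mono powr_mono2)
    fix i assume "i \<in> {..<m}"
    then have "dist z (u i) \<le> R" "dist z (w i) \<le> R"
      using S assms(5) by (auto simp: image_subset_iff subset_iff)
    then show "norm (u i - w i) \<le> 2 * R"
      using dist_triangle3[of "u i" "w i" z] by (simp add: dist_norm)
  qed (use assms(2) in auto)
  finally show ?thesis
    by simp
qed

text \<open>For \<open>m \<noteq> 0\<close>, cancel one factor \<open>m\<close> and take the root of
  order \<open>p - 1\<close>.\<close>

lemma le_powr_conjugate_exponent:
  fixes m a p :: real
  assumes "1 < p" and "0 \<le> m" and "0 \<le> a" and "m powr p \<le> a powr p * m"
  shows "m \<le> a powr (p / (p - 1))"
proof (cases "m = 0")
  case False
  have "m powr (p - 1) * m = m powr p"
    using assms(2) False by (simp add: powr_diff)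
  also have "\<dots> \<le> a powr p * m"
    by fact
  finally have "m powr (p - 1) \<le> a powr p"
    using assms(2) False by simp
  then have "(m powr (p - 1)) powr (1 / (p - 1)) \<le> (a powr p) powr (1 / (p - 1))"
    using assms(1) by (intro powr_mono2) auto
  then show ?thesis
    using assms(1,2) by (simp add: powr_powr)
qed simp

lemma shattered_card_le:
  fixes S :: "'a::real_normed_vector set"
  assumes "rademacher_type_bound TYPE('a) p T" and "1 < p" and "0 < \<Delta>" and "0 \<le> R"
    and "finite S" and "S \<subseteq> cball z R" and "shattered_by (gap_tolerant_classifiers \<Delta>) S"
  shows "real (card S) \<le> 2 * (T * R / \<Delta>) powr (p / (p - 1)) + 1"
proof -
  define m where "m = card S div 2"
  have T: "0 \<le> T"
    using assms(1) by (simp add: rademacher_type_bound_def)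
  have "(2 * real m * \<Delta>) powr p \<le> T powr p * (real m * (2 * R) powr p)"
    using assms m_def by (intro shattered_half_card_powr_le) auto
  \<comment> \<open>Writing \<open>R\<close> as \<open>(R / \<Delta>) * \<Delta>\<close> exposes the
    common factor \<open>(2 * \<Delta>) powr p\<close>.\<close>
  then have "real m powr p * (2 * \<Delta>) powr p \<le> (T * R / \<Delta>) powr p * real m * (2 * \<Delta>) powr p"
    using assms(3,4) T by (simp add: powr_mult powr_divide mult_ac)
  then have "real m powr p \<le> (T * R / \<Delta>) powr p * real m"
    using assms(3) by simp
  then have "real m \<le> (T * R / \<Delta>) powr (p / (p - 1))"
    using assms(2-4) T by (intro le_powr_conjugate_exponent) auto
  \<comment> \<open>Rounding down in the pairing loses at most one point.\<close>
  moreover have "card S \<le> 2 * m + 1"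
    unfolding m_def by linarith
  then have "real (card S) \<le> 2 * real m + 1"
    by linarith
  ultimately show ?thesis
    by linarith
qed

text \<open>Cardinalities are integers, so they are bounded by the floor of \<open>c\<close>; this
  bounds the supremum within \<open>enat\<close> before the passage to \<open>ereal\<close>.\<close>

lemma VC_dimension_le:
  assumes "0 \<le> c"
    and "\<And>S. finite S \<Longrightarrow> S \<subseteq> B \<Longrightarrow> shattered_by C S \<Longrightarrow> real (card S) \<le> c"
  shows "ereal_of_enat (VC_dimension C B) \<le> ereal c"
proof -
  have "VC_dimension C B \<le> enat (nat \<lfloor>c\<rfloor>)"
    unfolding VC_dimension_def using assms(2) by (intro SUP_least) (auto simp: le_nat_floor)
  then have "ereal_of_enat (VC_dimension C B) \<le> ereal_of_enat (enat (nat \<lfloor>c\<rfloor>))"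
    by (simp only: ereal_of_enat_le_iff)
  also have "\<dots> \<le> ereal c"
    using assms(1) by simp
  finally show ?thesis .
qed

theorem lemma4:
  fixes p T R \<Delta> :: real and z :: "'a::banach"
  assumes "1 < p" and "p \<le> 2"
    and "has_rademacher_type TYPE('a) p"
    and "T = rademacher_type_constant TYPE('a) p"
    and "0 < R" and "0 < \<Delta>"
  shows "ereal_of_enat (VC_dimension (gap_tolerant_classifiers \<Delta>) (cball z R))
           \<le> ereal ((3 * T * R / \<Delta>) powr (p / (p - 1)) + 64)"
proof (rule VC_dimension_le)
  define q where "q = p / (p - 1)"
  have type: "rademacher_type_bound TYPE('a) p T"
    unfolding assms(4) using assms(1,3) by (intro rademacher_type_constant_bound) auto
  then have T: "0 \<le> T"
    by (simp add: rademacher_type_bound_def)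
  \<comment> \<open>As \<open>q \<ge> 1\<close>, \<open>3 powr q\<close> is at least
    \<open>3\<close>, so the constant 3 inside the power absorbs the factor 2 from pairing; the
    summand 64 covers the leftover point.\<close>
  have "1 \<le> q"
    using assms(1) by (simp add: q_def)
  then have "(3::real) powr 1 \<le> 3 powr q"
    by (intro powr_mono) auto
  then have "2 * (T * R / \<Delta>) powr q \<le> 3 powr q * (T * R / \<Delta>) powr q"
    by (intro mult_right_mono) auto
  also have "\<dots> = (3 * T * R / \<Delta>) powr q"
    using T assms(5,6) by (simp add: powr_mult powr_divide mult_ac)
  finally have le: "2 * (T * R / \<Delta>) powr q \<le> (3 * T * R / \<Delta>) powr q" .
  show "real (card S) \<le> (3 * T * R / \<Delta>) powr (p / (p - 1)) + 64"
    if "finite S" "S \<subseteq> cball z R" "shattered_by (gap_tolerant_classifiers \<Delta>) S" for S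
    using shattered_card_le[OF type assms(1,6) _ that] assms(5) le unfolding q_def by linarith
qed simp

end
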